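(* Let $Q$ be a non-abelian finite simple group and $g\ge1$. Let $N$ be the number of epimorphisms from the free group $F_g$ onto $Q$ modulo $\mathrm{Aut}(Q)$, and let $\mu=N/|Q|^g$. Then the limiting probability (as the complexity $n\to\infty$) that the group of a random $g$-generator, $g$-relator presentation of complexity $n$ has an epimorphism onto $Q$ equals $$p(Q,g,g)=1-\bigl(1-|Q|^{-g}\bigr)^{|Q|^g\mu}\ (\approx 1-e^{-\mu}).$$ Moreover, as $g\to\infty$, $\mu\to 1/|\mathrm{Aut}(Q)|$, and the limiting distributions (as $n\to\infty$) of the number of epimorphisms onto $Q$ modulo $\mathrm{Aut}(Q)$ converge, as $g\to\infty$, to the Poisson distribution with mean $1/|\mathrm{Aut}(Q)|$.
   Context: A random relator of length $n$ in $F_g=\langle a_1,\dots,a_g\rangle$ is a word $x_1\cdots x_n$ with each $x_j\in\{a_1^{\pm1},\dots,a_g^{\pm1},1\}$, all $(2g+1)^n$ words equally likely; a random balanced presentation of complexity $n$ uses $g$ independent random relators of length $n$. The Poisson distribution with mean $\mu>0$ assigns probability $\mu^ke^{-\mu}/k!$ to $k\in\mathbb{Z}_{\ge0}$. *)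

theory Defs
  imports "HOL-Analysis.Analysis" "HOL-Algebra.SimpleGroups" "HOL-Algebra.Bij" "HOL-Algebra.Generated_Groups"
begin

text \<open>Letters of the alphabet {a_1^{+-1},...,a_g^{+-1},1} are encoded as integers in {-g..g}:
  0 is the empty letter 1, k > 0 is a_k, k < 0 is a_(-k)^(-1).
  A word (relator) is a list of letters.  A g-tuple of elements of Q is a list of length g.\<close>

definition letters :: "nat \<Rightarrow> int set" where
  "letters g = {- int g .. int g}"

definition eval_letter :: "('a, 'b) monoid_scheme \<Rightarrow> 'a list \<Rightarrow> int \<Rightarrow> 'a" where
  "eval_letter Q xs c =
     (if c = 0 then \<one>\<^bsub>Q\<^esub>
      else if c > 0 then xs ! (nat c - 1)
      else inv\<^bsub>Q\<^esub> (xs ! (nat (- c) - 1)))"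

definition eval_word :: "('a, 'b) monoid_scheme \<Rightarrow> 'a list \<Rightarrow> int list \<Rightarrow> 'a" where
  "eval_word Q xs w = foldr (\<lambda>c a. eval_letter Q xs c \<otimes>\<^bsub>Q\<^esub> a) w \<one>\<^bsub>Q\<^esub>"

text \<open>Epimorphisms from <a_1..a_g | P> onto Q, identified (universal property of presentations)
  with g-tuples of Q that generate Q and on which every relator of P evaluates to 1.\<close>
definition epi_tuples :: "('a, 'b) monoid_scheme \<Rightarrow> nat \<Rightarrow> int list list \<Rightarrow> 'a list set" where
  "epi_tuples Q g P = {xs. length xs = g \<and> set xs \<subseteq> carrier Q
      \<and> generate Q (set xs) = carrier Q
      \<and> (\<forall>r \<in> set P. eval_word Q xs r = \<one>\<^bsub>Q\<^esub>)}"

definition epi_orbits :: "('a, 'b) monoid_scheme \<Rightarrow> nat \<Rightarrow> int list list \<Rightarrow> 'a list set set" where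
  "epi_orbits Q g P = (\<lambda>xs. {map \<phi> xs | \<phi>. \<phi> \<in> auto Q}) ` epi_tuples Q g P"

definition num_epi :: "('a, 'b) monoid_scheme \<Rightarrow> nat \<Rightarrow> int list list \<Rightarrow> nat" where
  "num_epi Q g P = card (epi_orbits Q g P)"

definition N_epi :: "('a, 'b) monoid_scheme \<Rightarrow> nat \<Rightarrow> nat" where
  "N_epi Q g = num_epi Q g []"

definition mu :: "('a, 'b) monoid_scheme \<Rightarrow> nat \<Rightarrow> real" where
  "mu Q g = real (N_epi Q g) / real (card (carrier Q)) ^ g"

text \<open>All balanced presentations of complexity n: g relators, each a word of length n
  (there are (2g+1)^(ng) of them, all equally likely).\<close>
definition presentations :: "nat \<Rightarrow> nat \<Rightarrow> int list list set" where
  "presentations g n = {P. length P = g \<and> (\<forall>w \<in> set P. length w = n \<and> set w \<subseteq> letters g)}"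

definition prob_pres :: "nat \<Rightarrow> nat \<Rightarrow> (int list list \<Rightarrow> bool) \<Rightarrow> real" where
  "prob_pres g n E = real (card {P \<in> presentations g n. E P}) / real (card (presentations g n))"

definition poisson_pmf :: "real \<Rightarrow> nat \<Rightarrow> real" where
  "poisson_pmf m k = m ^ k * exp (- m) / fact k"

end

theory Submission
  imports Defs "HOL-Algebra.Product_Groups"
begin

text \<open>Choose representatives \<open>x\<^sub>1, \<dots>, x\<^sub>N\<close> of the \<open>Aut(Q)\<close>-orbits of generating \<open>g\<close>-tuples.  Since \<open>Q\<close> is
  non-abelian simple, the joint evaluation of words at all of them maps the free group onto \<open>Q\<^sup>N\<close>: for
  inequivalent epimorphisms the kernel of one maps onto \<open>Q\<close> under the other, and commutators
  extend this to intersections of kernels.  Hence a long random relator evaluates to a nearly uniform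
  element of \<open>Q\<^sup>N\<close>, by convergence of a random walk on a finite group, so in the limit the \<open>N\<close> events
  that all \<open>g\<close> relators vanish at \<open>x\<^sub>i\<close> are independent of probability \<open>|Q|\<^sup>-\<^sup>g\<close> each, and the number of
  epimorphisms up to \<open>Aut(Q)\<close> is binomially distributed.  Automorphisms act freely on generating
  tuples, and almost all tuples generate for large \<open>g\<close>, so \<open>\<mu> \<rightarrow> 1 / |Aut(Q)|\<close> and the binomial laws
  become Poisson.\<close>

section \<open>Random walks on finite groups\<close>

text \<open>The group and the letter map \<open>s\<close> are parameters because the walk is run
  both in \<open>Q\<close> and in a direct power of \<open>Q\<close>.\<close>

definition word_prod :: "('a, 'b) monoid_scheme \<Rightarrow> ('c \<Rightarrow> 'a) \<Rightarrow> 'c list \<Rightarrow> 'a" where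
  "word_prod G s w = foldr (\<lambda>c a. s c \<otimes>\<^bsub>G\<^esub> a) w \<one>\<^bsub>G\<^esub>"

lemma word_prod_Nil [simp]: "word_prod G s [] = \<one>\<^bsub>G\<^esub>"
  and word_prod_Cons [simp]: "word_prod G s (c # w) = s c \<otimes>\<^bsub>G\<^esub> word_prod G s w"
  by (simp_all add: word_prod_def)

context group
begin

lemma word_prod_closed [simp]:
  assumes "s \<in> S \<rightarrow> carrier G" "set w \<subseteq> S"
  shows "word_prod G s w \<in> carrier G"
  using assms by (induction w) (auto simp: Pi_iff)

lemma word_prod_append:
  assumes "s \<in> S \<rightarrow> carrier G" "set u \<subseteq> S" "set v \<subseteq> S"
  shows "word_prod G s (u @ v) = word_prod G s u \<otimes> word_prod G s v"
  using assms(2)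
proof (induction u)
  case Nil
  then show ?case using word_prod_closed[OF assms(1,3)] by simp
next
  case (Cons c u)
  moreover have "s c \<in> carrier G" using Cons.prems assms(1) by auto
  ultimately show ?case
    using word_prod_closed[OF assms(1)] assms(3) by (auto simp: m_assoc)
qed

lemma word_prod_replicate_one:
  assumes "s e = \<one>"
  shows "word_prod G s (replicate n e) = \<one>"
  by (induction n) (auto simp: assms)

text \<open>Doeblin's argument: padding with \<open>e\<close> makes every element the product of a word of one
  common length \<open>m\<close>.  Averaged over one such word per element, the deviation from the uniform
  distribution cancels, so \<open>m\<close> steps shrink it by the factor \<open>1 - |G| / |S|^m\<close>.\<close>

lemma word_prod_equidistributed:
  assumes fin: "finite (carrier G)" and S: "finite S" and s: "s \<in> S \<rightarrow> carrier G"
    and e: "e \<in> S" "s e = \<one>"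
    and reach: "\<And>y. y \<in> carrier G \<Longrightarrow> \<exists>w. set w \<subseteq> S \<and> word_prod G s w = y"
    and x: "x \<in> carrier G"
  shows "(\<lambda>n. real (card {w. length w = n \<and> set w \<subseteq> S \<and> word_prod G s w = x}) / real (card S) ^ n)
           \<longlonglongrightarrow> 1 / real (card (carrier G))"
proof -
  define W where "W n = {w. length w = n \<and> set w \<subseteq> S}" for n
  define C where "C n y = card {w \<in> W n. word_prod G s w = y}" for n y
  define K where "K = real (card S)"
  define q where "q = real (card (carrier G))"
  \<comment> \<open>The deviation from the uniform distribution after \<open>n\<close>
    steps.\<close>
  define h where "h n y = real (C n y) / K ^ n - 1 / q" for n y
  note closed = word_prod_closed[OF s]
  have finW [simp]: "finite (W n)" for n
    using finite_lists_length_eq[OF S, of n] by (simp add: W_def conj_commute)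
  have cardW: "real (card (W n)) = K ^ n" for n
    using card_lists_length_eq[OF S, of n] by (simp add: W_def K_def conj_commute)
  have K: "K > 0" using S e by (auto simp: K_def card_gt_0_iff)
  have q: "q > 0" using fin by (auto simp: q_def card_gt_0_iff)
  have WC: "word_prod G s w \<in> carrier G" if "w \<in> W n" for w n
    using that closed by (auto simp: W_def)

  \<comment> \<open>Cutting each word after its first \<open>m\<close> letters turns the count into
    a convolution over prefixes.\<close>
  have conv: "C (m + n) y = (\<Sum>u\<in>W m. C n (inv (word_prod G s u) \<otimes> y))" if y: "y \<in> carrier G" for m n y
  proof -
    have eq: "word_prod G s (u @ v) = y \<longleftrightarrow> word_prod G s v = inv (word_prod G s u) \<otimes> y"
      if "u \<in> W m" "v \<in> W n" for u v
    proof -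
      have "word_prod G s (u @ v) = word_prod G s u \<otimes> word_prod G s v"
        using that by (intro word_prod_append[OF s]) (auto simp: W_def)
      then show ?thesis
        using WC[OF that(1)] WC[OF that(2)] y by (metis inv_closed inv_solve_left)
    qed
    have "bij_betw (\<lambda>(u, v). u @ v) (SIGMA u:W m. {v \<in> W n. word_prod G s v = inv (word_prod G s u) \<otimes> y})
            {w \<in> W (m + n). word_prod G s w = y}"
    proof (rule bij_betw_byWitness[where f' = "\<lambda>w. (take m w, drop m w)"], goal_cases)
      case 1
      then show ?case by (auto simp: W_def)
    next
      case 2
      then show ?case by auto
    next
      case 3
      then show ?case using eq by (auto simp: W_def)
    next
      case 4
      have "take m w \<in> W m \<and> drop m w \<in> W n" if "w \<in> W (m + n)" for w
        using that by (auto simp: W_def dest: in_set_takeD in_set_dropD)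
      then show ?case using eq by (fastforce simp: append_take_drop_id)
    qed
    then have "C (m + n) y = card (SIGMA u:W m. {v \<in> W n. word_prod G s v = inv (word_prod G s u) \<otimes> y})"
      by (simp add: C_def bij_betw_same_card)
    also have "\<dots> = (\<Sum>u\<in>W m. C n (inv (word_prod G s u) \<otimes> y))"
      by (subst card_SigmaI) (auto simp: C_def)
    finally show ?thesis .
  qed
  have hconv: "h (m + n) y = (\<Sum>u\<in>W m. h n (inv (word_prod G s u) \<otimes> y)) / K ^ m" if y: "y \<in> carrier G" for m n y
  proof -
    have "(\<Sum>u\<in>W m. h n (inv (word_prod G s u) \<otimes> y))
        = (\<Sum>u\<in>W m. real (C n (inv (word_prod G s u) \<otimes> y))) / K ^ n - K ^ m / q"
      by (simp add: h_def sum_subtractf sum_divide_distrib cardW)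
    also have "\<dots> = real (C (m + n) y) / K ^ n - K ^ m / q"
      by (simp add: conv[OF y])
    finally have sum_h: "(\<Sum>u\<in>W m. h n (inv (word_prod G s u) \<otimes> y)) = real (C (m + n) y) / K ^ n - K ^ m / q" .
    show ?thesis unfolding sum_h using K
      by (simp add: h_def diff_divide_distrib power_add mult.commute)
  qed
  have "(\<Sum>y\<in>carrier G. C n y) = card (W n)" for n
  proof -
    have "(\<Sum>y\<in>carrier G. C n y) = (\<Sum>y\<in>carrier G. \<Sum>w\<in>{w \<in> W n. word_prod G s w = y}. 1)"
      by (simp add: C_def)
    also have "\<dots> = (\<Sum>w\<in>W n. 1)"
      using WC by (intro sum.group) (auto simp: fin)
    finally show ?thesis by simp
  qed
  then have "(\<Sum>y\<in>carrier G. real (C n y)) = K ^ n" for n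
    by (metis cardW of_nat_sum)
  then have hsum: "(\<Sum>y\<in>carrier G. h n y) = 0" for n
    using K q by (simp add: h_def sum_subtractf flip: sum_divide_distrib) (simp add: q_def)
  \<comment> \<open>The map taking \<open>z\<close> to \<open>inv z \<otimes> y\<close> permutes the
    group, so the deviations still sum to zero.\<close>
  have hsum': "(\<Sum>z\<in>carrier G. h n (inv z \<otimes> y)) = 0" if y: "y \<in> carrier G" for n y
  proof -
    have "bij_betw (\<lambda>z. inv z \<otimes> y) (carrier G) (carrier G)"
      by (rule bij_betw_byWitness[where f' = "\<lambda>z. y \<otimes> inv z"])
         (use y in \<open>auto simp: inv_mult_group m_assoc[symmetric]\<close>, simp add: m_assoc)
    from sum.reindex_bij_betw[OF this, of "h n"] hsum show ?thesis by simp
  qed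

  obtain v0 where v0: "\<And>y. y \<in> carrier G \<Longrightarrow> set (v0 y) \<subseteq> S \<and> word_prod G s (v0 y) = y"
    using reach by metis
  \<comment> \<open>At least the length of every chosen word; the \<open>Suc\<close> makes
    \<open>m\<close> positive, as the later division by \<open>m\<close> needs.\<close>
  define m where "m = Suc (Max ((length \<circ> v0) ` carrier G))"
  have m: "m > 0" by (simp add: m_def)
  define v where "v y = v0 y @ replicate (m - length (v0 y)) e" for y
  have v: "v y \<in> W m \<and> word_prod G s (v y) = y" if "y \<in> carrier G" for y
  proof -
    have "length (v0 y) \<le> m"
      using that fin unfolding m_def by (intro le_SucI Max_ge) auto
    moreover have "word_prod G s (v y) = y"
      unfolding v_def using v0[OF that] e that
      by (subst word_prod_append[OF s]) (auto simp: word_prod_replicate_one)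
    ultimately show ?thesis
      using v0[OF that] e by (auto simp: W_def v_def)
  qed
  have injv: "inj_on v (carrier G)"
    using v by (metis inj_onI)
  define V where "V = v ` carrier G"
  have V: "V \<subseteq> W m" "real (card V) = q"
    using v injv by (auto simp: V_def q_def card_image)
  define c where "c = 1 - q / K ^ m"
  have "q \<le> K ^ m"
    using card_mono[OF finW V(1)] V(2) cardW[of m] by linarith
  then have c: "0 \<le> c" "c < 1" using K q by (auto simp: c_def field_simps)

  have contract: "\<bar>h (m + n) y\<bar> \<le> c * B"
    if B: "\<And>y. y \<in> carrier G \<Longrightarrow> \<bar>h n y\<bar> \<le> B" and y: "y \<in> carrier G" for n B y
  proof -
    let ?t = "\<lambda>u. h n (inv (word_prod G s u) \<otimes> y)"
    \<comment> \<open>\<open>V\<close> holds exactly one word for each group element, so its terms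
      form a full sum of deviations and cancel; only \<open>K ^ m - q\<close> prefixes
      remain.\<close>
    have "sum ?t V = (\<Sum>z\<in>carrier G. h n (inv z \<otimes> y))"
      unfolding V_def using v by (subst sum.reindex[OF injv]) (auto intro!: sum.cong)
    then have "sum ?t V = 0" using hsum' y by simp
    then have "sum ?t (W m) = sum ?t (W m - V)"
      by (simp add: sum_diff V(1))
    also have "\<bar>\<dots>\<bar> \<le> (\<Sum>u\<in>W m - V. B)"
      using WC y by (intro order_trans[OF sum_abs] sum_mono B) auto
    also have "\<dots> = (K ^ m - q) * B"
      using V finite_subset[OF V(1)] cardW[of m] card_mono[OF finW V(1)]
      by (simp add: card_Diff_subset of_nat_diff)
    finally have "\<bar>sum ?t (W m)\<bar> \<le> (K ^ m - q) * B" .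
    then have "\<bar>sum ?t (W m)\<bar> / K ^ m \<le> (K ^ m - q) * B / K ^ m"
      using K by (intro divide_right_mono) auto
    moreover have "\<bar>h (m + n) y\<bar> = \<bar>sum ?t (W m)\<bar> / K ^ m"
      using K by (simp add: hconv[OF y] abs_divide)
    moreover have "(K ^ m - q) * B / K ^ m = c * B"
      using K by (simp add: c_def field_simps)
    ultimately show ?thesis by simp
  qed
  \<comment> \<open>Each full block of \<open>m\<close> steps gains a factor \<open>c\<close>; the
    remaining \<open>n mod m\<close> steps only use the trivial bound 1.\<close>
  have bound: "\<bar>h n y\<bar> \<le> c ^ (n div m)" if "y \<in> carrier G" for n y
    using that
  proof (induction n arbitrary: y rule: less_induct)
    case (less n)
    show ?case
    proof (cases "n < m")
      case True
      have "C n y \<le> card (W n)" unfolding C_def by (intro card_mono) auto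
      then have "real (C n y) / K ^ n \<le> 1" using K cardW[of n] by (simp add: field_simps)
      moreover have "1 / q \<le> 1"
        using fin q by (simp add: q_def)
      moreover have "0 \<le> real (C n y) / K ^ n" "0 \<le> 1 / q" using K q by auto
      ultimately have "\<bar>h n y\<bar> \<le> 1" unfolding h_def by linarith
      then show ?thesis using True by simp
    next
      case False
      define n' where "n' = n - m"
      have n: "n = m + n'" "n' < n" using False m by (auto simp: n'_def)
      have "n div m = Suc (n' div m)" using m by (simp add: n(1))
      then show ?thesis
        using contract[of n', OF less.IH[OF n(2)] less.prems] by (simp add: n(1))
    qed
  qed
  have "(\<lambda>n. h n x) \<longlonglongrightarrow> 0"
  proof (rule Lim_null_comparison)
    show "\<forall>\<^sub>F n in sequentially. norm (h n x) \<le> c ^ (n div m)"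
      using bound[OF x] by simp
    have "filterlim (\<lambda>n. n div m) sequentially sequentially"
      unfolding filterlim_at_top
    proof
      fix Z
      show "\<forall>\<^sub>F n in sequentially. Z \<le> n div m"
        using eventually_ge_at_top[of "Z * m"]
        by eventually_elim (metis div_le_mono m less_irrefl nonzero_mult_div_cancel_right)
    qed
    then show "(\<lambda>n. c ^ (n div m)) \<longlonglongrightarrow> 0"
      using c by (intro filterlim_compose[OF LIMSEQ_power_zero]) auto
  qed
  then have "(\<lambda>n. h n x + 1 / q) \<longlonglongrightarrow> 0 + 1 / q"
    by (intro tendsto_intros)
  then show ?thesis
    by (simp add: h_def C_def W_def K_def q_def conj_assoc)
qed

end

section \<open>Joint evaluation of words\<close>

locale finite_nonabelian_simple_group = simple_group +
  assumes nonabelian: "\<not> comm_group G" and finite_carrier [simp]: "finite (carrier G)"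

text \<open>Negating a code inverts its letter and fixes the empty letter \<open>0\<close>; with the
  reversal this is the formal inverse in the free group.\<close>

definition inv_word :: "int list \<Rightarrow> int list" where
  "inv_word w = map uminus (rev w)"

text \<open>Each tuple stands for the homomorphism from the free group of rank \<open>g\<close>
  sending the generators to its entries; \<open>epi_tuples G g []\<close> are the surjective
  ones.\<close>

definition tuples :: "('a, 'b) monoid_scheme \<Rightarrow> nat \<Rightarrow> 'a list set" where
  "tuples G g = {xs. length xs = g \<and> set xs \<subseteq> carrier G}"

lemma uminus_letters [simp]: "- c \<in> letters g \<longleftrightarrow> c \<in> letters g"
  by (auto simp: letters_def)

lemma inv_word_lists [simp]: "inv_word w \<in> lists (letters g) \<longleftrightarrow> w \<in> lists (letters g)"
  by (induction w) (auto simp: inv_word_def)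

lemma epi_tuples_Nil: "epi_tuples G g [] = {xs \<in> tuples G g. generate G (set xs) = carrier G}"
  by (auto simp: epi_tuples_def tuples_def)

lemma epi_tuples_imp_tuples: "xs \<in> epi_tuples G g P \<Longrightarrow> xs \<in> tuples G g"
  by (auto simp: epi_tuples_def tuples_def)

lemma eval_word_conv_word_prod: "eval_word G xs = word_prod G (eval_letter G xs)"
  by (simp add: eval_word_def word_prod_def fun_eq_iff)

context group
begin

lemma eval_letter_funcset:
  assumes "xs \<in> tuples G g"
  shows "eval_letter G xs \<in> letters g \<rightarrow> carrier G"
proof
  fix c assume c: "c \<in> letters g"
  have "xs ! i \<in> carrier G" if "i < g" for i
    using that assms nth_mem by (fastforce simp: tuples_def)
  moreover have "c > 0 \<Longrightarrow> nat c - 1 < g" "c < 0 \<Longrightarrow> nat (- c) - 1 < g"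
    using c by (auto simp: letters_def)
  ultimately show "eval_letter G xs c \<in> carrier G"
    by (auto simp: eval_letter_def)
qed

lemma eval_word_closed [simp]:
  "xs \<in> tuples G g \<Longrightarrow> w \<in> lists (letters g) \<Longrightarrow> eval_word G xs w \<in> carrier G"
  unfolding eval_word_conv_word_prod
  by (rule word_prod_closed[OF eval_letter_funcset]) auto

lemma eval_word_append:
  "xs \<in> tuples G g \<Longrightarrow> u \<in> lists (letters g) \<Longrightarrow> v \<in> lists (letters g) \<Longrightarrow>
    eval_word G xs (u @ v) = eval_word G xs u \<otimes> eval_word G xs v"
  unfolding eval_word_conv_word_prod
  by (rule word_prod_append[OF eval_letter_funcset]) auto

lemma eval_letter_uminus:
  assumes "xs \<in> tuples G g" "c \<in> letters g"
  shows "eval_letter G xs (- c) = inv (eval_letter G xs c)"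
proof -
  have "eval_letter G xs c \<in> carrier G" "eval_letter G xs (- c) \<in> carrier G"
    using eval_letter_funcset[OF assms(1)] assms(2) by auto
  then show ?thesis
    by (cases c "0::int" rule: linorder_cases) (auto simp: eval_letter_def)
qed

lemma eval_word_singleton:
  assumes "xs \<in> tuples G g" "c \<in> letters g"
  shows "eval_word G xs [c] = eval_letter G xs c"
  using funcset_mem[OF eval_letter_funcset[OF assms(1)] assms(2)] by (simp add: eval_word_def)

lemma eval_word_inv_word:
  assumes xs: "xs \<in> tuples G g" and "w \<in> lists (letters g)"
  shows "eval_word G xs (inv_word w) = inv (eval_word G xs w)"
  using assms(2)
proof (induction w)
  case Nil
  then show ?case by (simp add: eval_word_def inv_word_def)
next
  case (Cons c w)
  have c: "eval_letter G xs c \<in> carrier G" using eval_letter_funcset[OF xs] Cons by auto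
  have "inv_word (c # w) = inv_word w @ [- c]" by (simp add: inv_word_def)
  then have "eval_word G xs (inv_word (c # w)) = inv (eval_word G xs w) \<otimes> inv (eval_letter G xs c)"
    using Cons xs by (simp add: eval_word_append[of _ g] eval_word_singleton[of _ g] eval_letter_uminus[of _ g])
  also have "\<dots> = inv (eval_letter G xs c \<otimes> eval_word G xs w)"
    using c Cons xs by (simp add: inv_mult_group)
  finally show ?case by (simp add: eval_word_def)
qed

text \<open>List positions start at 0 but generator codes at 1, since 0 is the empty letter; hence
  the shift.\<close>

lemma nth_conv_eval_word:
  assumes "xs \<in> tuples G g" "k < g"
  shows "[int k + 1] \<in> lists (letters g)" "xs ! k = eval_word G xs [int k + 1]"
proof -
  show l: "[int k + 1] \<in> lists (letters g)" using assms by (auto simp: letters_def)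
  have "nat (int k + 1) - 1 = k" by simp
  then show "xs ! k = eval_word G xs [int k + 1]"
    using eval_word_singleton[OF assms(1), of "int k + 1"] l by (simp add: eval_letter_def)
qed

lemma generate_subset_eval_word:
  assumes xs: "xs \<in> tuples G g"
  shows "generate G (set xs) \<subseteq> eval_word G xs ` lists (letters g)"
proof
  fix y assume "y \<in> generate G (set xs)"
  then show "y \<in> eval_word G xs ` lists (letters g)"
  proof (induction rule: generate.induct)
    case one
    then show ?case by (auto simp: eval_word_def intro!: image_eqI[of _ _ "[]"])
  next
    case (incl h)
    then show ?case
      using nth_conv_eval_word[OF xs] xs by (auto simp: in_set_conv_nth tuples_def)
  next
    case (inv h)
    then obtain k where k: "h = xs ! k" "k < g"
      using xs by (auto simp: in_set_conv_nth tuples_def)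
    note nth_conv_eval_word[OF xs k(2)]
    then show ?case using k eval_word_inv_word[OF xs] inv_word_lists by (metis image_eqI)
  next
    case (eng h1 h2)
    then obtain u v where "u \<in> lists (letters g)" "v \<in> lists (letters g)"
      "h1 = eval_word G xs u" "h2 = eval_word G xs v" by auto
    then show ?case
      using eval_word_append[OF xs] by (metis append_in_lists_conv image_eqI)
  qed
qed

lemma eval_word_surj:
  assumes "xs \<in> epi_tuples G g []"
  shows "eval_word G xs ` lists (letters g) = carrier G"
  using generate_subset_eval_word[of xs g] eval_word_closed[OF epi_tuples_imp_tuples[OF assms]] assms
  unfolding epi_tuples_Nil by blast

text \<open>The intersection of the kernels of the homomorphisms in \<open>Y\<close>, seen on
  unreduced words.\<close>

definition vanishing_words :: "nat \<Rightarrow> 'a list set \<Rightarrow> int list set" where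
  "vanishing_words g Y = {w \<in> lists (letters g). \<forall>ys\<in>Y. eval_word G ys w = \<one>}"

lemma vanishing_words_append:
  assumes "Y \<subseteq> tuples G g" "u \<in> vanishing_words g Y" "v \<in> vanishing_words g Y"
  shows "u @ v \<in> vanishing_words g Y"
  using assms eval_word_append[of _ g u v] by (auto simp: vanishing_words_def)

lemma vanishing_words_inv_word:
  assumes "Y \<subseteq> tuples G g" "u \<in> vanishing_words g Y"
  shows "inv_word u \<in> vanishing_words g Y"
  using assms eval_word_inv_word[of _ g u] by (auto simp: vanishing_words_def)

lemma vanishing_words_conj:
  assumes "Y \<subseteq> tuples G g" "u \<in> vanishing_words g Y" "w \<in> lists (letters g)"
  shows "w @ u @ inv_word w \<in> vanishing_words g Y"
proof -
  have u: "u \<in> lists (letters g)" using assms(2) by (simp add: vanishing_words_def)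
  have "eval_word G ys (w @ u @ inv_word w) = \<one>" if "ys \<in> Y" for ys
  proof -
    have ys: "ys \<in> tuples G g" "eval_word G ys u = \<one>"
      using that assms(1,2) by (auto simp: vanishing_words_def)
    then show ?thesis
      using u assms(3) eval_word_closed[OF ys(1) assms(3)]
      by (simp add: eval_word_append[of _ g] eval_word_inv_word[of _ g])
  qed
  then show ?thesis using u assms(3) by (simp add: vanishing_words_def)
qed

text \<open>Surjective homomorphisms carry normal subgroups to normal subgroups: conjugation by
  \<open>x\<close> lifts to conjugation by a word because \<open>xs\<close> generates
  \<open>G\<close>. In a simple group the image is therefore trivial or everything.\<close>

lemma eval_vanishing_words_normal:
  assumes xs: "xs \<in> epi_tuples G g []" and Y: "Y \<subseteq> tuples G g"
  shows "eval_word G xs ` vanishing_words g Y \<lhd> G"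
proof -
  note xs' = epi_tuples_imp_tuples[OF xs]
  have words: "u \<in> lists (letters g)" if "u \<in> vanishing_words g Y" for u
    using that by (simp add: vanishing_words_def)
  show ?thesis unfolding normal_inv_iff
  proof (intro conjI ballI subgroupI)
    show "eval_word G xs ` vanishing_words g Y \<subseteq> carrier G"
      using xs' words by auto
    have "[] \<in> vanishing_words g Y" by (auto simp: vanishing_words_def eval_word_def)
    then show "eval_word G xs ` vanishing_words g Y \<noteq> {}" by auto
  next
    fix a assume "a \<in> eval_word G xs ` vanishing_words g Y"
    then obtain u where u: "u \<in> vanishing_words g Y" "a = eval_word G xs u" by auto
    then have "inv a = eval_word G xs (inv_word u)"
      using eval_word_inv_word[OF xs' words] by simp
    then show "inv a \<in> eval_word G xs ` vanishing_words g Y"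
      using vanishing_words_inv_word[OF Y u(1)] by simp
  next
    fix a b assume "a \<in> eval_word G xs ` vanishing_words g Y" "b \<in> eval_word G xs ` vanishing_words g Y"
    then obtain u v where uv: "u \<in> vanishing_words g Y" "a = eval_word G xs u"
      "v \<in> vanishing_words g Y" "b = eval_word G xs v" by auto
    then have "a \<otimes> b = eval_word G xs (u @ v)"
      using eval_word_append[OF xs' words words] by simp
    then show "a \<otimes> b \<in> eval_word G xs ` vanishing_words g Y"
      using vanishing_words_append[OF Y uv(1,3)] by simp
  next
    fix x a assume "x \<in> carrier G" and a: "a \<in> eval_word G xs ` vanishing_words g Y"
    then obtain w where w: "w \<in> lists (letters g)" "x = eval_word G xs w"
      using eval_word_surj[OF xs] by auto
    obtain u where u: "u \<in> vanishing_words g Y" "a = eval_word G xs u" using a by auto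
    have "x \<otimes> a \<otimes> inv x = eval_word G xs (w @ u @ inv_word w)"
      using w u words[OF u(1)] xs'
      by (simp add: eval_word_append[of _ g] eval_word_inv_word[of _ g] m_assoc)
    then show "x \<otimes> a \<otimes> inv x \<in> eval_word G xs ` vanishing_words g Y"
      using vanishing_words_conj[OF Y u(1) w(1)] by simp
  qed
qed

text \<open>The homomorphism of the free group given by \<open>xs\<close> kills the kernel of the one given by \<open>ys\<close>,
  so it factors through it.\<close>

lemma automorphism_of_vanishing:
  assumes fin: "finite (carrier G)"
    and xs: "xs \<in> epi_tuples G g []" and ys: "ys \<in> epi_tuples G g []"
    and triv: "eval_word G xs ` vanishing_words g {ys} \<subseteq> {\<one>}"
  shows "\<exists>\<phi>\<in>auto G. xs = map \<phi> ys"
proof -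
  note xs' = epi_tuples_imp_tuples[OF xs] and ys' = epi_tuples_imp_tuples[OF ys]
  let ?L = "lists (letters g)"
  \<comment> \<open>An element is sent to the value under \<open>xs\<close> of some word
    representing it under \<open>ys\<close>; the restriction makes the map extensional, as
    \<open>auto\<close> demands.\<close>
  define \<phi> where "\<phi> = (\<lambda>q\<in>carrier G. eval_word G xs (SOME w. w \<in> ?L \<and> eval_word G ys w = q))"
  have factor: "\<phi> (eval_word G ys w) = eval_word G xs w" if w: "w \<in> ?L" for w
  proof -
    define u where "u = (SOME u. u \<in> ?L \<and> eval_word G ys u = eval_word G ys w)"
    have u: "u \<in> ?L" "eval_word G ys u = eval_word G ys w"
      using someI[of "\<lambda>u. u \<in> ?L \<and> eval_word G ys u = eval_word G ys w" w] w by (auto simp: u_def)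
    \<comment> \<open>Words with equal value under \<open>ys\<close> differ by a word vanishing
      there, so the choice of word does not matter.\<close>
    have "u @ inv_word w \<in> vanishing_words g {ys}"
      using u w ys' by (auto simp: vanishing_words_def eval_word_append[of _ g] eval_word_inv_word[of _ g])
    then have "eval_word G xs (u @ inv_word w) = \<one>" using triv by auto
    then have "eval_word G xs u \<otimes> inv (eval_word G xs w) = \<one>"
      using u w xs' by (simp add: eval_word_append[of _ g] eval_word_inv_word[of _ g])
    then have "eval_word G xs u = eval_word G xs w"
      using u w xs' by (metis eval_word_closed inv_closed inv_equality inv_inv)
    then show ?thesis using w ys' by (simp add: \<phi>_def u_def)
  qed
  have img: "\<phi> ` carrier G = carrier G"
    using factor eval_word_surj[OF xs] eval_word_surj[OF ys] by (metis (no_types, lifting) image_cong image_image)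
  have "\<phi> \<in> hom G G"
  proof (rule homI)
    fix a b assume "a \<in> carrier G" "b \<in> carrier G"
    then obtain u v where uv: "u \<in> ?L" "v \<in> ?L" "a = eval_word G ys u" "b = eval_word G ys v"
      using eval_word_surj[OF ys] by (metis imageE)
    have "\<phi> (a \<otimes> b) = \<phi> (eval_word G ys (u @ v))"
      using uv ys' by (simp add: eval_word_append[of _ g])
    also have "\<dots> = eval_word G xs (u @ v)" using uv by (intro factor) simp
    also have "\<dots> = \<phi> a \<otimes> \<phi> b"
      using uv xs' by (simp add: eval_word_append[of _ g] factor)
    finally show "\<phi> (a \<otimes> b) = \<phi> a \<otimes> \<phi> b" .
  qed (use img in auto)
  \<comment> \<open>A surjective self-map of a finite set is injective.\<close>
  moreover have "bij_betw \<phi> (carrier G) (carrier G)"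
    using img finite_surj_inj[OF fin, of \<phi>] by (simp add: bij_betw_def)
  ultimately have "\<phi> \<in> auto G" by (auto simp: auto_def Bij_def \<phi>_def)
  moreover have "xs = map \<phi> ys"
  proof (rule nth_equalityI)
    show "length xs = length (map \<phi> ys)" using xs' ys' by (simp add: tuples_def)
    fix k assume "k < length xs"
    then have k: "k < g" "k < length ys" using xs' ys' by (auto simp: tuples_def)
    then show "xs ! k = map \<phi> ys ! k"
      using nth_conv_eval_word[OF xs' k(1)] nth_conv_eval_word[OF ys' k(1)] factor by simp
  qed
  ultimately show ?thesis by blast
qed

end

section \<open>Joint surjectivity from simplicity\<close>

context finite_nonabelian_simple_group
begin

lemma ex_noncommuting: "\<exists>a\<in>carrier G. \<exists>b\<in>carrier G. a \<otimes> b \<noteq> b \<otimes> a"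
  using nonabelian group_comm_groupI by blast

text \<open>By simplicity the image is trivial or all of \<open>G\<close>, and a trivial image would
  make \<open>xs\<close> the image of \<open>ys\<close> under an automorphism.\<close>

lemma eval_vanishing_words_pair:
  assumes "xs \<in> epi_tuples G g []" "ys \<in> epi_tuples G g []" "\<not> (\<exists>\<phi>\<in>auto G. xs = map \<phi> ys)"
  shows "eval_word G xs ` vanishing_words g {ys} = carrier G"
  using automorphism_of_vanishing[OF finite_carrier assms(1,2)] assms(3)
    no_real_normal_subgroup[OF eval_vanishing_words_normal[OF assms(1), of "{ys}"]]
    epi_tuples_imp_tuples[OF assms(2)] by blast

text \<open>A commutator of a word vanishing on \<open>Y\<close> with one vanishing on \<open>ys\<close> vanishes on both.\<close>

lemma eval_vanishing_words:
  assumes xs: "xs \<in> epi_tuples G g []" and "finite Y" "Y \<subseteq> epi_tuples G g []"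
    and "\<And>ys. ys \<in> Y \<Longrightarrow> \<not> (\<exists>\<phi>\<in>auto G. xs = map \<phi> ys)"
  shows "eval_word G xs ` vanishing_words g Y = carrier G"
  using assms(2-)
proof (induction Y)
  case empty
  then show ?case using eval_word_surj[OF xs] by (simp add: vanishing_words_def)
next
  case (insert ys Y)
  note xs' = epi_tuples_imp_tuples[OF xs]
  have Y: "insert ys Y \<subseteq> tuples G g" using insert.prems(1) epi_tuples_imp_tuples by blast
  \<comment> \<open>Two noncommuting elements are lifted to words: \<open>u\<close> by the induction
    hypothesis, \<open>v\<close> by the case of a single tuple.\<close>
  obtain a b where ab: "a \<in> carrier G" "b \<in> carrier G" "a \<otimes> b \<noteq> b \<otimes> a"
    using ex_noncommuting by blast
  obtain u where u: "u \<in> vanishing_words g Y" "a = eval_word G xs u"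
    using insert ab(1) by (metis (no_types, lifting) imageE insert_iff subset_insertI subset_trans)
  obtain v where v: "v \<in> vanishing_words g {ys}" "b = eval_word G xs v"
    using eval_vanishing_words_pair[OF xs, of ys] insert.prems ab(2) by (metis (no_types, lifting) imageE insert_iff insert_subset)
  have uv: "u \<in> lists (letters g)" "v \<in> lists (letters g)"
    using u v by (auto simp: vanishing_words_def)
  define w where "w = (u @ v @ inv_word u) @ inv_word v"
  have Y': "{ys} \<subseteq> tuples G g" "Y \<subseteq> tuples G g" using Y by auto
  \<comment> \<open>The two bracketings show the commutator as a conjugate of \<open>v\<close> times
    the inverse of \<open>v\<close>, and as \<open>u\<close> times a conjugate of the inverse of
    \<open>u\<close>.\<close>
  have "(u @ v @ inv_word u) @ inv_word v \<in> vanishing_words g {ys}"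
    by (intro vanishing_words_append vanishing_words_conj vanishing_words_inv_word Y' v uv)
  moreover have "u @ (v @ inv_word u @ inv_word v) \<in> vanishing_words g Y"
    by (intro vanishing_words_append vanishing_words_conj vanishing_words_inv_word Y' u uv)
  ultimately have "w \<in> vanishing_words g (insert ys Y)"
    by (auto simp: vanishing_words_def w_def)
  moreover have "eval_word G xs w = a \<otimes> b \<otimes> inv a \<otimes> inv b"
    using uv xs' ab u(2) v(2) by (simp add: w_def eval_word_append[of _ g] eval_word_inv_word[of _ g] m_assoc)
  moreover have "a \<otimes> b \<otimes> inv a \<otimes> inv b \<noteq> \<one>"
    using ab by (metis inv_closed inv_equality inv_inv inv_solve_right m_closed)
  ultimately have "eval_word G xs ` vanishing_words g (insert ys Y) \<noteq> {\<one>}" by force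
  then show ?case
    using no_real_normal_subgroup[OF eval_vanishing_words_normal[OF xs Y]] by blast
qed

text \<open>Values are prescribed one tuple at a time: each tuple of \<open>R\<close> admits words
  with any given value there that vanish on the rest of \<open>R\<close>, and these are
  concatenated.\<close>

lemma joint_eval_surj:
  assumes fin: "finite R" and R: "R \<subseteq> epi_tuples G g []"
    and ineq: "\<And>xs ys. xs \<in> R \<Longrightarrow> ys \<in> R \<Longrightarrow> xs \<noteq> ys \<Longrightarrow> \<not> (\<exists>\<phi>\<in>auto G. xs = map \<phi> ys)"
    and v: "v \<in> R \<rightarrow> carrier G"
  shows "\<exists>w\<in>lists (letters g). \<forall>xs\<in>R. eval_word G xs w = v xs"
proof -
  have "\<exists>w\<in>lists (letters g). \<forall>xs\<in>R. eval_word G xs w = (if xs \<in> T then v xs else \<one>)"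
    if "finite T" "T \<subseteq> R" for T
    using that
  proof (induction T)
    case empty
    then show ?case by (intro bexI[of _ "[]"]) (auto simp: eval_word_def)
  next
    case (insert ys T)
    then obtain w where w: "w \<in> lists (letters g)"
      "\<And>xs. xs \<in> R \<Longrightarrow> eval_word G xs w = (if xs \<in> T then v xs else \<one>)" by auto
    have "eval_word G ys ` vanishing_words g (R - {ys}) = carrier G"
    proof (rule eval_vanishing_words)
      show "\<not> (\<exists>\<phi>\<in>auto G. ys = map \<phi> xs)" if "xs \<in> R - {ys}" for xs
        by (rule ineq) (use that insert.prems in auto)
      show "ys \<in> epi_tuples G g []" "R - {ys} \<subseteq> epi_tuples G g []" using insert.prems R by blast+
    qed (use fin in simp)
    then obtain u where u: "u \<in> vanishing_words g (R - {ys})" "eval_word G ys u = v ys"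
      using funcset_mem[OF v, of ys] insert.prems by (metis (no_types, lifting) imageE insert_subset)
    have ul: "u \<in> lists (letters g)" using u by (simp add: vanishing_words_def)
    \<comment> \<open>\<open>u\<close> contributes only at \<open>ys\<close>, and \<open>w\<close>
      is trivial at \<open>ys\<close> because \<open>ys\<close> lies outside
      \<open>T\<close>.\<close>
    have "eval_word G xs (u @ w) = (if xs \<in> insert ys T then v xs else \<one>)" if xs: "xs \<in> R" for xs
    proof -
      have "eval_word G xs (u @ w) = eval_word G xs u \<otimes> eval_word G xs w"
        using xs R epi_tuples_imp_tuples by (intro eval_word_append[OF _ ul w(1)]) blast
      moreover have "eval_word G xs u = \<one>" if "xs \<noteq> ys"
        using that xs u(1) by (simp add: vanishing_words_def)
      moreover have "v xs \<in> carrier G" using v xs by auto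
      ultimately show ?thesis using u(2) w(2)[OF xs] insert.hyps by (cases "xs = ys") auto
    qed
    moreover have "u @ w \<in> lists (letters g)" using ul w(1) by simp
    ultimately show ?case by blast
  qed
  from this[OF fin] show ?thesis by auto
qed

end

section \<open>Orbits of generating tuples\<close>

context group
begin

lemma eval_word_map:
  assumes \<phi>: "\<phi> \<in> hom G G" and xs: "xs \<in> tuples G g" and w: "w \<in> lists (letters g)"
  shows "eval_word G (map \<phi> xs) w = \<phi> (eval_word G xs w)"
proof -
  interpret h: group_hom G G \<phi> by unfold_locales (rule \<phi>)
  have "eval_letter G (map \<phi> xs) c = \<phi> (eval_letter G xs c)" if "c \<in> letters g" for c
  proof -
    have k: "c > 0 \<Longrightarrow> nat c - 1 < g" "c < 0 \<Longrightarrow> nat (- c) - 1 < g"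
      using that by (auto simp: letters_def)
    then have "c < 0 \<Longrightarrow> xs ! (nat (- c) - 1) \<in> carrier G"
      using xs nth_mem[of "nat (- c) - 1" xs] by (auto simp: tuples_def)
    then show ?thesis using k xs by (auto simp: eval_letter_def tuples_def)
  qed
  then show ?thesis using w
  proof (induction w)
    case (Cons c w)
    then show ?case
      using eval_word_closed[OF xs, of w] funcset_mem[OF eval_letter_funcset[OF xs], of c]
      by (simp add: eval_word_def)
  qed (simp add: eval_word_def)
qed

definition orbit :: "'a list \<Rightarrow> 'a list set" where
  "orbit xs = {map \<phi> xs | \<phi>. \<phi> \<in> auto G}"

lemma auto_hom: "\<phi> \<in> auto G \<Longrightarrow> \<phi> \<in> hom G G"
  by (simp add: auto_def)

lemma auto_compose:
  assumes "\<phi> \<in> auto G" "\<psi> \<in> auto G"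
  shows "compose (carrier G) \<phi> \<psi> \<in> auto G"
  using subgroup.m_closed[OF subgroup_auto assms] assms
  by (simp add: BijGroup_def auto_def)

lemma auto_inverse:
  assumes "\<phi> \<in> auto G"
  shows "restrict (inv_into (carrier G) \<phi>) (carrier G) \<in> auto G"
  using assms restrict_inv_into_hom[of \<phi>] restrict_inv_into_Bij[of \<phi> "carrier G"]
  by (simp add: auto_def)

lemma orbit_self:
  assumes "xs \<in> tuples G g"
  shows "xs \<in> orbit xs"
proof -
  \<comment> \<open>Members of \<open>auto\<close> are extensional, so the identity enters as its
    restriction to the carrier.\<close>
  have "map (\<lambda>x\<in>carrier G. x) xs = xs"
    using assms by (intro map_idI) (auto simp: tuples_def)
  then show ?thesis using id_in_auto unfolding orbit_def by force
qed

lemma map_auto_tuples: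
  "xs \<in> tuples G g \<Longrightarrow> \<phi> \<in> auto G \<Longrightarrow> map \<phi> xs \<in> tuples G g"
  by (auto simp: tuples_def auto_def hom_def)

lemma orbit_subset:
  assumes "xs \<in> tuples G g" "ys \<in> orbit xs"
  shows "orbit ys \<subseteq> orbit xs"
proof
  fix zs assume "zs \<in> orbit ys"
  then obtain \<phi> \<psi> where *: "\<phi> \<in> auto G" "\<psi> \<in> auto G" "ys = map \<phi> xs" "zs = map \<psi> ys"
    using assms(2) by (auto simp: orbit_def)
  then have "zs = map (compose (carrier G) \<psi> \<phi>) xs"
    using assms(1) by (auto simp: tuples_def compose_def)
  then show "zs \<in> orbit xs" using auto_compose[OF *(2,1)] by (auto simp: orbit_def)
qed

lemma orbit_eq:
  assumes xs: "xs \<in> tuples G g" and ys: "ys \<in> orbit xs"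
  shows "orbit ys = orbit xs"
proof
  show "orbit ys \<subseteq> orbit xs" by (rule orbit_subset[OF assms])
  obtain \<phi> where \<phi>: "\<phi> \<in> auto G" "ys = map \<phi> xs" using ys by (auto simp: orbit_def)
  have "inj_on \<phi> (carrier G)" using \<phi>(1) by (auto simp: auto_def Bij_def bij_betw_def)
  moreover have "\<phi> x \<in> carrier G" if "x \<in> carrier G" for x
    using \<phi>(1) that by (auto simp: auto_def hom_def)
  ultimately have "map (restrict (inv_into (carrier G) \<phi>) (carrier G)) ys = xs"
    unfolding \<phi>(2) map_map using xs by (intro map_idI) (auto simp: tuples_def subset_iff)
  then have "xs \<in> orbit ys" using auto_inverse[OF \<phi>(1)] by (auto simp: orbit_def)
  then show "orbit xs \<subseteq> orbit ys" using \<phi> xs map_auto_tuples by (intro orbit_subset) auto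
qed

lemma epi_orbits_conv_orbit: "epi_orbits G g P = orbit ` epi_tuples G g P"
  by (simp add: epi_orbits_def orbit_def)

lemma epi_tuples_conv_Nil:
  "epi_tuples G g P = {xs \<in> epi_tuples G g []. \<forall>r\<in>set P. eval_word G xs r = \<one>}"
  by (auto simp: epi_tuples_def)

text \<open>Automorphisms preserve both generation and the vanishing of relators.\<close>

lemma orbit_epi_tuples:
  assumes xs: "xs \<in> epi_tuples G g P" and P: "set P \<subseteq> lists (letters g)"
  shows "orbit xs \<subseteq> epi_tuples G g P"
proof
  fix ys assume "ys \<in> orbit xs"
  then obtain \<phi> where \<phi>: "\<phi> \<in> auto G" "ys = map \<phi> xs" by (auto simp: orbit_def)
  interpret h: group_hom G G \<phi> by unfold_locales (rule auto_hom[OF \<phi>(1)])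
  note xs' = epi_tuples_imp_tuples[OF xs]
  have "generate G (\<phi> ` set xs) = \<phi> ` generate G (set xs)"
    using xs' by (intro h.generate_img) (simp add: tuples_def)
  also have "\<dots> = carrier G"
    using xs \<phi>(1) by (simp add: epi_tuples_def auto_def Bij_def bij_betw_def)
  finally have "generate G (set ys) = carrier G" using \<phi>(2) by simp
  moreover have "eval_word G ys r = \<one>" if "r \<in> set P" for r
    using eval_word_map[OF h.homh xs', of r] that P xs \<phi>(2) by (auto simp: epi_tuples_def)
  ultimately show "ys \<in> epi_tuples G g P"
    using map_auto_tuples[OF xs' \<phi>(1)] \<phi>(2) by (auto simp: epi_tuples_def tuples_def)
qed

text \<open>An automorphism is determined by its values on generators; thus the action on generating
  tuples is free.\<close>

lemma inj_on_map_auto: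
  assumes xs: "xs \<in> epi_tuples G g []"
  shows "inj_on (\<lambda>\<phi>. map \<phi> xs) (auto G)"
proof (rule inj_onI)
  fix \<phi> \<psi> assume *: "\<phi> \<in> auto G" "\<psi> \<in> auto G" "map \<phi> xs = map \<psi> xs"
  show "\<phi> = \<psi>"
  proof (rule extensionalityI[where A = "carrier G"])
    fix x assume "x \<in> carrier G"
    then obtain w where "w \<in> lists (letters g)" "x = eval_word G xs w"
      using eval_word_surj[OF xs] by blast
    then show "\<phi> x = \<psi> x"
      using eval_word_map[OF auto_hom epi_tuples_imp_tuples[OF xs]] * by metis
  qed (use * in \<open>auto simp: auto_def Bij_def\<close>)
qed

section \<open>Counting generating tuples and their orbits\<close>

lemma finite_tuples: "finite (carrier G) \<Longrightarrow> finite (tuples G g)"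
  and card_tuples: "finite (carrier G) \<Longrightarrow> card (tuples G g) = card (carrier G) ^ g"
  using finite_lists_length_eq[of "carrier G" g] card_lists_length_eq[of "carrier G" g]
  unfolding tuples_def by (simp_all add: conj_commute)

lemma finite_epi_tuples: "finite (carrier G) \<Longrightarrow> finite (epi_tuples G g P)"
  by (rule finite_subset[OF subsetI finite_tuples]) (rule epi_tuples_imp_tuples)

lemma finite_auto: "finite (carrier G) \<Longrightarrow> finite (auto G)"
  by (rule finite_subset[OF _ finite_PiE[of "carrier G" "\<lambda>_. carrier G"]])
     (auto simp: auto_def Bij_def hom_def PiE_def)

text \<open>The orbits partition the generating tuples, and by freeness each is as large as
  \<open>auto G\<close>.\<close>

lemma card_epi_tuples:
  assumes fin: "finite (carrier G)"
  shows "card (epi_tuples G g []) = card (auto G) * N_epi G g"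
proof -
  have Un: "\<Union> (epi_orbits G g []) = epi_tuples G g []"
  proof
    show "\<Union> (epi_orbits G g []) \<subseteq> epi_tuples G g []"
      unfolding epi_orbits_conv_orbit by (intro UN_least orbit_epi_tuples) simp_all
    show "epi_tuples G g [] \<subseteq> \<Union> (epi_orbits G g [])"
      unfolding epi_orbits_conv_orbit using orbit_self[OF epi_tuples_imp_tuples] by blast
  qed
  have "card (auto G) * card (epi_orbits G g []) = card (\<Union> (epi_orbits G g []))"
  proof (rule card_partition)
    show "finite (epi_orbits G g [])" "finite (\<Union> (epi_orbits G g []))"
      using finite_epi_tuples[OF fin] unfolding Un by (auto simp: epi_orbits_conv_orbit)
    show "card c = card (auto G)" if "c \<in> epi_orbits G g []" for c
    proof -
      obtain xs where "xs \<in> epi_tuples G g []" "c = (\<lambda>\<phi>. map \<phi> xs) ` auto G"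
        using \<open>c \<in> epi_orbits G g []\<close> by (auto simp: epi_orbits_conv_orbit orbit_def)
      then show ?thesis using inj_on_map_auto by (simp add: card_image)
    qed
    show "c1 \<inter> c2 = {}" if c: "c1 \<in> epi_orbits G g []" "c2 \<in> epi_orbits G g []" "c1 \<noteq> c2" for c1 c2
    proof (rule ccontr)
      assume "c1 \<inter> c2 \<noteq> {}"
      then obtain zs where "zs \<in> c1" "zs \<in> c2" by auto
      moreover obtain xs ys where "xs \<in> epi_tuples G g []" "c1 = orbit xs" "ys \<in> epi_tuples G g []" "c2 = orbit ys"
        using c(1,2) unfolding epi_orbits_conv_orbit by blast
      ultimately show False using c(3) orbit_eq[OF epi_tuples_imp_tuples] by metis
    qed
  qed
  then show ?thesis by (simp add: Un N_epi_def num_epi_def)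
qed

text \<open>Vanishing of the relators is constant on orbits, so it may be tested on one
  representative of each.\<close>

lemma num_epi_conv_representatives:
  assumes R: "R \<subseteq> epi_tuples G g []" "inj_on orbit R" "orbit ` R = epi_orbits G g []"
    and P: "set P \<subseteq> lists (letters g)"
  shows "num_epi G g P = card {xs \<in> R. \<forall>r\<in>set P. eval_word G xs r = \<one>}" (is "_ = card ?S")
proof -
  have "orbit ` ?S = epi_orbits G g P"
  proof (intro equalityI subsetI)
    fix c assume "c \<in> epi_orbits G g P"
    then obtain xs where xs: "xs \<in> epi_tuples G g P" "c = orbit xs" by (auto simp: epi_orbits_conv_orbit)
    then have "orbit xs \<in> orbit ` R" using R(3) by (auto simp: epi_orbits_conv_orbit epi_tuples_conv_Nil[of g P])
    then obtain ys where ys: "ys \<in> R" "orbit ys = orbit xs" by auto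
    then have "ys \<in> orbit xs" using orbit_self[OF epi_tuples_imp_tuples] R(1) by blast
    then have "ys \<in> epi_tuples G g P" using orbit_epi_tuples[OF xs(1) P] by blast
    then show "c \<in> orbit ` ?S" using ys xs by (auto simp: epi_tuples_conv_Nil[of g P])
  qed (use R(1) in \<open>auto simp: epi_orbits_conv_orbit epi_tuples_conv_Nil[of g P]\<close>)
  moreover have "inj_on orbit ?S" using R(2) by (rule inj_on_subset) auto
  then have "card (orbit ` ?S) = card ?S" by (rule card_image)
  ultimately show ?thesis by (simp add: num_epi_def)
qed

text \<open>The direct power multiplies coordinatewise, so reading a word at all tuples of
  \<open>R\<close> is a walk in it.\<close>

lemma word_prod_product_group:
  "word_prod (product_group R (\<lambda>_. G)) (\<lambda>c. \<lambda>xs\<in>R. eval_letter G xs c) w = (\<lambda>xs\<in>R. eval_word G xs w)"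
  by (induction w) (simp_all add: eval_word_def cong: restrict_cong)

text \<open>Tuples not generating \<open>G\<close> miss some element of \<open>G\<close>.\<close>

lemma card_tuples_le_epi_tuples:
  assumes fin: "finite (carrier G)"
  shows "card (carrier G) ^ g \<le> card (epi_tuples G g []) + card (carrier G) * (card (carrier G) - 1) ^ g"
proof -
  let ?M = "\<lambda>a. {xs. set xs \<subseteq> carrier G - {a} \<and> length xs = g}"
  have "tuples G g \<subseteq> epi_tuples G g [] \<union> (\<Union>a\<in>carrier G. ?M a)"
  proof
    fix xs assume xs: "xs \<in> tuples G g"
    have "generate G (carrier G) = carrier G"
      using generate_incl[of "carrier G"] generate.incl[of _ "carrier G" G] by blast
    then show "xs \<in> epi_tuples G g [] \<union> (\<Union>a\<in>carrier G. ?M a)"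
      using xs unfolding epi_tuples_Nil tuples_def by (cases "set xs = carrier G") auto
  qed
  then have "card (tuples G g) \<le> card (epi_tuples G g [] \<union> (\<Union>a\<in>carrier G. ?M a))"
    using fin by (intro card_mono) (auto simp: finite_epi_tuples finite_lists_length_eq)
  also have "\<dots> \<le> card (epi_tuples G g []) + (\<Sum>a\<in>carrier G. card (?M a))"
    using card_Un_le[of "epi_tuples G g []" "\<Union>a\<in>carrier G. ?M a"] card_UN_le[OF fin, of ?M] by linarith
  also have "(\<Sum>a\<in>carrier G. card (?M a)) = card (carrier G) * (card (carrier G) - 1) ^ g"
    using fin by (simp add: card_lists_length_eq card_Diff_singleton)
  finally show ?thesis using card_tuples[OF fin] by simp
qed

text \<open>With q = |G|, the proportion of generating tuples lies between 1 - q((q-1)/q)^g and 1;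
  dividing it by the order of \<open>auto G\<close> gives \<open>mu\<close>.\<close>

lemma mu_tendsto:
  assumes fin: "finite (carrier G)"
  shows "mu G \<longlonglongrightarrow> 1 / real (card (auto G))"
proof -
  define q where "q = real (card (carrier G))"
  define a where "a g = real (card (epi_tuples G g [])) / q ^ g" for g
  have c: "card (carrier G) > 0" using fin by (auto simp: card_gt_0_iff)
  then have q: "q > 0" by (simp add: q_def)
  have "1 - q * ((q - 1) / q) ^ g \<le> a g" for g
  proof -
    have "q ^ g \<le> real (card (epi_tuples G g [])) + q * (q - 1) ^ g"
      using of_nat_mono[where 'a = real, OF card_tuples_le_epi_tuples[OF fin, of g]] c
      by (simp add: q_def of_nat_diff)
    then have "q ^ g / q ^ g \<le> (real (card (epi_tuples G g [])) + q * (q - 1) ^ g) / q ^ g"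
      using q by (intro divide_right_mono) auto
    then show ?thesis using q by (simp add: a_def add_divide_distrib power_divide)
  qed
  moreover have "a g \<le> 1" for g
    using card_mono[OF finite_tuples[OF fin], of "epi_tuples G g []" g] epi_tuples_imp_tuples[of _ G g "[]"]
      card_tuples[OF fin, of g] q
    by (auto simp: a_def q_def field_simps subset_iff simp flip: of_nat_power)
  moreover have "(\<lambda>g. 1 - q * ((q - 1) / q) ^ g) \<longlonglongrightarrow> 1 - q * 0"
    using q c by (intro tendsto_intros LIMSEQ_power_zero) (auto simp: q_def field_simps)
  ultimately have "a \<longlonglongrightarrow> 1"
    by (intro tendsto_sandwich[of "\<lambda>g. 1 - q * ((q - 1) / q) ^ g" a _ "\<lambda>_. 1"]) auto
  then have "(\<lambda>g. a g / real (card (auto G))) \<longlonglongrightarrow> 1 / real (card (auto G))"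
    using id_in_auto finite_auto[OF fin] by (intro tendsto_divide) auto
  moreover have "a g / real (card (auto G)) = mu G g" for g
    using id_in_auto finite_auto[OF fin] card_epi_tuples[OF fin, of g]
    by (auto simp: a_def mu_def q_def)
  ultimately show ?thesis by simp
qed

end

section \<open>The limiting distribution\<close>

text \<open>This encodes the independence of the relators: an event constraining each position
  separately has a product count.\<close>

lemma card_lists_of_nth_in:
  "card {P. length P = g \<and> (\<forall>j<g. P ! j \<in> A j)} = (\<Prod>j<g. card (A j))"
proof -
  have "bij_betw (\<lambda>P. \<lambda>j\<in>{..<g}. P ! j) {P. length P = g \<and> (\<forall>j<g. P ! j \<in> A j)} (PiE {..<g} A)"
  proof (rule bij_betw_byWitness[where f' = "\<lambda>f. map f [0..<g]"], goal_cases)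
    case 1
    then show ?case by (auto intro: nth_equalityI)
  next
    case 2
    show ?case
    proof
      fix f assume f: "f \<in> PiE {..<g} A"
      show "(\<lambda>j\<in>{..<g}. map f [0..<g] ! j) = f"
        using PiE_arb[OF f] by (auto simp: fun_eq_iff)
    qed
  next
    case 3
    then show ?case by (intro image_subsetI restrict_PiE_iff[THEN iffD2]) simp
  next
    case 4
    then show ?case by (intro image_subsetI) (simp add: PiE_mem)
  qed
  then show ?thesis by (simp add: bij_betw_same_card card_PiE)
qed

text \<open>Once the \<open>k\<close> arguments with value \<open>b\<close> are chosen, every other
  argument has \<open>card B - 1\<close> values left: the binomial law in counting form.\<close>

lemma card_PiE_hitting_value:
  assumes R: "finite R" and B: "finite B" "b \<in> B"
  shows "card {T \<in> R \<rightarrow>\<^sub>E B. card {x \<in> R. T x = b} = k} = (card R choose k) * (card B - 1) ^ (card R - k)"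
proof -
  \<comment> \<open>For \<open>S\<close> inside \<open>R\<close>, the functions equal to
    \<open>b\<close> exactly on \<open>S\<close>; different \<open>S\<close> give disjoint
    sets.\<close>
  let ?F = "\<lambda>S. PiE R (\<lambda>x. if x \<in> S then {b} else B - {b})"
  have eq: "{T \<in> R \<rightarrow>\<^sub>E B. card {x \<in> R. T x = b} = k} = (\<Union>S\<in>{S. S \<subseteq> R \<and> card S = k}. ?F S)"
  proof (intro equalityI subsetI)
    fix T assume T: "T \<in> {T \<in> R \<rightarrow>\<^sub>E B. card {x \<in> R. T x = b} = k}"
    then have "T \<in> R \<rightarrow>\<^sub>E B" by simp
    then have "T \<in> ?F {x \<in> R. T x = b}" by (simp add: PiE_iff)
    moreover have "{x \<in> R. T x = b} \<in> {S. S \<subseteq> R \<and> card S = k}" using T by auto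
    ultimately show "T \<in> (\<Union>S\<in>{S. S \<subseteq> R \<and> card S = k}. ?F S)" by (rule UN_I[rotated])
  next
    fix T assume "T \<in> (\<Union>S\<in>{S. S \<subseteq> R \<and> card S = k}. ?F S)"
    then obtain S where S: "S \<subseteq> R" "card S = k" "T \<in> ?F S" by (elim UN_E CollectE conjE)
    then have mem: "\<And>x. x \<in> R \<Longrightarrow> T x \<in> (if x \<in> S then {b} else B - {b})" by (simp only: PiE_iff)
    then have "{x \<in> R. T x = b} = S" "\<And>x. x \<in> R \<Longrightarrow> T x \<in> B"
      using S(1) B(2) by (fastforce split: if_splits)+
    moreover have "T \<in> extensional R" using S(3) by (simp add: PiE_iff)
    ultimately show "T \<in> {T \<in> R \<rightarrow>\<^sub>E B. card {x \<in> R. T x = b} = k}"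
      using S(2) by (simp add: PiE_iff)
  qed
  have disj: "?F S \<inter> ?F S' = {}" if "S \<subseteq> R" "S' \<subseteq> R" "S \<noteq> S'" for S S'
  proof (rule ccontr)
    assume "?F S \<inter> ?F S' \<noteq> {}"
    then obtain T where T: "T \<in> ?F S" "T \<in> ?F S'" by blast
    have "x \<in> S \<longleftrightarrow> x \<in> S'" if "x \<in> R" for x
      using PiE_mem[OF T(1) that] PiE_mem[OF T(2) that] by (simp split: if_splits)
    with \<open>S \<noteq> S'\<close> \<open>S \<subseteq> R\<close> \<open>S' \<subseteq> R\<close> show False by blast
  qed
  have cardF: "card (?F S) = (card B - 1) ^ (card R - k)" if S: "S \<subseteq> R" "card S = k" for S
  proof -
    have "card (?F S) = (\<Prod>x\<in>R. if x \<in> S then 1 else card B - 1)"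
      using R B by (subst card_PiE) (auto intro!: prod.cong simp: card_Diff_singleton)
    also have "\<dots> = (card B - 1) ^ card (R - S)"
      using R by (simp add: prod.If_cases Diff_eq)
    finally show ?thesis using S R by (simp add: card_Diff_subset finite_subset)
  qed
  have fin: "finite {S. S \<subseteq> R \<and> card S = k}" using R by simp
  have "finite (?F S)" for S using R B by (intro finite_PiE) auto
  then have "card {T \<in> R \<rightarrow>\<^sub>E B. card {x \<in> R. T x = b} = k} = (\<Sum>S\<in>{S. S \<subseteq> R \<and> card S = k}. card (?F S))"
    unfolding eq using fin disj by (intro card_UN_disjoint) auto
  also have "\<dots> = (card R choose k) * (card B - 1) ^ (card R - k)"
    using cardF n_subsets[OF R] by simp
  finally show ?thesis .
qed

section \<open>The binomial limit for fixed \<open>g\<close>\<close>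

context finite_nonabelian_simple_group
begin

text \<open>By joint surjectivity, reading a random relator at all orbit representatives at once is a
  random walk on \<open>Q\<^sup>N\<close>.\<close>

lemma joint_eval_equidistributed:
  assumes R: "R \<subseteq> epi_tuples G g []" "inj_on orbit R" and v: "v \<in> R \<rightarrow>\<^sub>E carrier G"
  shows "(\<lambda>n. real (card {w. length w = n \<and> set w \<subseteq> letters g \<and> (\<lambda>xs\<in>R. eval_word G xs w) = v})
           / real (card (letters g)) ^ n) \<longlonglongrightarrow> 1 / real (card (carrier G)) ^ card R"
proof -
  let ?H = "product_group R (\<lambda>_. G)"
  interpret H: group ?H by (rule product_group) (rule is_group)
  have finR: "finite R" by (rule finite_subset[OF R(1) finite_epi_tuples]) simp
  have card_H: "card (carrier ?H) = card (carrier G) ^ card R"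
    using finR by (simp add: card_PiE)
  \<comment> \<open>Representatives related by an automorphism share their orbit, hence
    coincide.\<close>
  have ineq: "\<not> (\<exists>\<phi>\<in>auto G. xs = map \<phi> ys)" if "xs \<in> R" "ys \<in> R" "xs \<noteq> ys" for xs ys
  proof
    assume "\<exists>\<phi>\<in>auto G. xs = map \<phi> ys"
    then have "xs \<in> orbit ys" by (auto simp: orbit_def)
    then have "orbit xs = orbit ys"
      using that R(1) by (intro orbit_eq[of ys g] epi_tuples_imp_tuples[of ys G g "[]"]) auto
    with that R(2) show False by (auto dest: inj_onD)
  qed
  have "(\<lambda>n. real (card {w. length w = n \<and> set w \<subseteq> letters g
            \<and> word_prod ?H (\<lambda>c. \<lambda>xs\<in>R. eval_letter G xs c) w = v})
           / real (card (letters g)) ^ n) \<longlonglongrightarrow> 1 / real (card (carrier ?H))"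
  \<comment> \<open>The empty letter \<open>0\<close> is the idle step \<open>e\<close> that rules
    out periodicity.\<close>
  proof (rule H.word_prod_equidistributed[where e = 0])
    show "finite (carrier ?H)" using finR by (auto intro: finite_PiE)
    show "finite (letters g)" "0 \<in> letters g" by (auto simp: letters_def)
    show "(\<lambda>c. \<lambda>xs\<in>R. eval_letter G xs c) \<in> letters g \<rightarrow> carrier ?H"
      using R(1) eval_letter_funcset[OF epi_tuples_imp_tuples] by fastforce
    show "(\<lambda>xs\<in>R. eval_letter G xs 0) = \<one>\<^bsub>?H\<^esub>" by (simp add: eval_letter_def)
    show "v \<in> carrier ?H" using v by simp
    fix y assume "y \<in> carrier ?H"
    then have y: "y \<in> R \<rightarrow>\<^sub>E carrier G" by simp
    then obtain w where "w \<in> lists (letters g)" "\<forall>xs\<in>R. eval_word G xs w = y xs"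
      using joint_eval_surj[OF finR R(1) ineq, of y] by auto
    then show "\<exists>w. set w \<subseteq> letters g \<and> word_prod ?H (\<lambda>c. \<lambda>xs\<in>R. eval_letter G xs c) w = y"
      using y by (intro exI[of _ w]) (auto simp: word_prod_product_group fun_eq_iff PiE_iff extensional_def)
  qed
  then show ?thesis by (simp only: word_prod_product_group card_H of_nat_power)
qed

text \<open>A presentation yields a table with one row of \<open>g\<close> relator values for each
  representative. In the limit all tables are equally likely, so counting those with exactly
  \<open>k\<close> trivial rows gives a binomial law.\<close>

lemma prob_num_epi_tendsto:
  "(\<lambda>n. prob_pres g n (\<lambda>P. num_epi G g P = k)) \<longlonglongrightarrow>
     real (N_epi G g choose k) * (1 / real (card (carrier G)) ^ g) ^ k
       * (1 - 1 / real (card (carrier G)) ^ g) ^ (N_epi G g - k)"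
proof -
  define q where "q = card (carrier G)"
  \<comment> \<open>One representative for each orbit, so that \<open>card R\<close> is N.\<close>
  obtain R where R: "R \<subseteq> epi_tuples G g []" "inj_on orbit R" "orbit ` R = epi_orbits G g []"
    using subset_image_inj[of "epi_orbits G g []" orbit "epi_tuples G g []"] epi_orbits_conv_orbit by auto
  have finR: "finite R" by (rule finite_subset[OF R(1) finite_epi_tuples]) simp
  have cardR: "card R = N_epi G g"
    using card_image[OF R(2)] R(3) by (simp add: N_epi_def num_epi_def)
  have q0: "q > 0" by (auto simp: q_def card_gt_0_iff)
  define W where "W n = {w. length w = n \<and> set w \<subseteq> letters g}" for n
  define K where "K = real (card (letters g))"
  have finl: "finite (letters g)" by (simp add: letters_def)
  have cardW: "real (card (W n)) = K ^ n" for n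
    using card_lists_length_eq[OF finl, of n] by (simp add: W_def K_def conj_commute)
  have finW: "finite (W n)" for n
    using finite_lists_length_eq[OF finl, of n] by (simp add: W_def conj_commute)
  have pres: "presentations g n = {P. length P = g \<and> (\<forall>j<g. P ! j \<in> W n)}" for n
    by (auto simp: presentations_def W_def in_set_conv_nth all_set_conv_all_nth)
  have cardp: "real (card (presentations g n)) = (K ^ n) ^ g" for n
    unfolding pres card_lists_of_nth_in by (simp add: cardW)
  have finp: "finite (presentations g n)" for n
  proof (rule finite_subset)
    show "presentations g n \<subseteq> {P. set P \<subseteq> W n \<and> length P = g}"
      by (auto simp: presentations_def W_def)
  qed (simp add: finite_lists_length_eq finW)
  define val where "val P = (\<lambda>xs\<in>R. map (eval_word G xs) P)" for P
  define B where "B = tuples G g"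
  \<comment> \<open>The trivial row: all \<open>g\<close> relators vanish at the representative,
    which is then an epimorphism of the presented group.\<close>
  define b where "b = replicate g \<one>"
  have Bb: "finite B" "b \<in> B" "card B = q ^ g"
    by (auto simp: B_def b_def finite_tuples card_tuples q_def) (auto simp: tuples_def)
  define A where "A = {T \<in> R \<rightarrow>\<^sub>E B. card {xs \<in> R. T xs = b} = k}"
  have words: "set P \<subseteq> lists (letters g)" if "P \<in> presentations g n" for P n
    using that by (auto simp: presentations_def)
  have val: "val P \<in> R \<rightarrow>\<^sub>E B" if "P \<in> presentations g n" for P n
  proof -
    have "length P = g" using that by (simp add: presentations_def)
    then have "map (eval_word G xs) P \<in> B" if "xs \<in> R" for xs
      using that words[OF \<open>P \<in> presentations g n\<close>] R(1) eval_word_closed[OF epi_tuples_imp_tuples]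
      by (fastforce simp: B_def tuples_def simp del: in_lists_conv_set)
    then show ?thesis by (auto simp: val_def)
  qed
  have ev: "num_epi G g P = k \<longleftrightarrow> val P \<in> A" if P: "P \<in> presentations g n" for P n
  proof -
    have "(\<forall>r\<in>set P. eval_word G xs r = \<one>) \<longleftrightarrow> map (eval_word G xs) P = b" for xs
      using P unfolding presentations_def b_def by (auto simp: list_eq_iff_nth_eq all_set_conv_all_nth)
    then have "{xs \<in> R. \<forall>r\<in>set P. eval_word G xs r = \<one>} = {xs \<in> R. val P xs = b}"
      by (auto simp: val_def)
    then show ?thesis
      using num_epi_conv_representatives[OF R words[OF P]] val[OF P] by (simp add: A_def)
  qed
  have finA: "finite A" unfolding A_def using finR Bb by (intro finite_subset[OF _ finite_PiE[of R "\<lambda>_. B"]]) auto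

  \<comment> \<open>Fixing the table prescribes the joint value of each relator separately, so the
    probability factors; each factor tends to |Q|^-N.\<close>
  have fiber: "(\<lambda>n. prob_pres g n (\<lambda>P. val P = T)) \<longlonglongrightarrow> (1 / real q ^ card R) ^ g" if T: "T \<in> R \<rightarrow>\<^sub>E B" for T
  proof -
    let ?D = "\<lambda>n j. {w. length w = n \<and> set w \<subseteq> letters g \<and> (\<lambda>xs\<in>R. eval_word G xs w) = (\<lambda>xs\<in>R. T xs ! j)}"
    have "{P \<in> presentations g n. val P = T} = {P. length P = g \<and> (\<forall>j<g. P ! j \<in> ?D n j)}" for n
    proof -
      have "val P = T \<longleftrightarrow> (\<forall>j<g. \<forall>xs\<in>R. eval_word G xs (P ! j) = T xs ! j)" if "length P = g" for P
      proof -
        have "val P = T \<longleftrightarrow> (\<forall>xs\<in>R. map (eval_word G xs) P = T xs)"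
          using T by (auto simp: val_def fun_eq_iff PiE_iff extensional_def)
        moreover have "map (eval_word G xs) P = T xs \<longleftrightarrow> (\<forall>j<g. eval_word G xs (P ! j) = T xs ! j)"
          if "xs \<in> R" for xs
        proof -
          have "length (T xs) = g" using PiE_mem[OF T that] by (simp add: B_def tuples_def)
          then show ?thesis using \<open>length P = g\<close> by (simp add: list_eq_iff_nth_eq)
        qed
        ultimately show ?thesis by blast
      qed
      moreover have "(\<lambda>xs\<in>R. eval_word G xs w) = (\<lambda>xs\<in>R. T xs ! j) \<longleftrightarrow> (\<forall>xs\<in>R. eval_word G xs w = T xs ! j)" for w j
        by (auto simp: fun_eq_iff)
      ultimately show ?thesis by (auto simp: pres W_def)
    qed
    then have "card {P \<in> presentations g n. val P = T} = (\<Prod>j<g. card (?D n j))" for n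
      using card_lists_of_nth_in[of g "?D n"] by simp
    then have "prob_pres g n (\<lambda>P. val P = T) = (\<Prod>j<g. real (card (?D n j)) / K ^ n)" for n
      by (simp add: prob_pres_def cardp prod_dividef)
    moreover have "(\<lambda>n. \<Prod>j<g. real (card (?D n j)) / K ^ n) \<longlonglongrightarrow> (\<Prod>j<g. 1 / real q ^ card R)"
    proof (intro tendsto_prod)
      fix j assume "j \<in> {..<g}"
      then have "T xs ! j \<in> carrier G" if "xs \<in> R" for xs
        using PiE_mem[OF T that] nth_mem[of j "T xs"] by (auto simp: B_def tuples_def)
      then show "(\<lambda>n. real (card (?D n j)) / K ^ n) \<longlonglongrightarrow> 1 / real q ^ card R"
        unfolding K_def q_def by (intro joint_eval_equidistributed R) auto
    qed
    ultimately show ?thesis by simp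
  qed
  have "prob_pres g n (\<lambda>P. num_epi G g P = k) = (\<Sum>T\<in>A. prob_pres g n (\<lambda>P. val P = T))" for n
  proof -
    have "{P \<in> presentations g n. num_epi G g P = k} = (\<Union>T\<in>A. {P \<in> presentations g n. val P = T})"
      using ev by auto
    moreover have "card (\<Union>T\<in>A. {P \<in> presentations g n. val P = T}) = (\<Sum>T\<in>A. card {P \<in> presentations g n. val P = T})"
      using finA finp by (intro card_UN_disjoint) auto
    ultimately show ?thesis by (simp add: prob_pres_def sum_divide_distrib)
  qed
  moreover have "(\<lambda>n. \<Sum>T\<in>A. prob_pres g n (\<lambda>P. val P = T)) \<longlonglongrightarrow> (\<Sum>T\<in>A. (1 / real q ^ card R) ^ g)"
    using fiber by (intro tendsto_sum) (auto simp: A_def)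
  moreover have "(\<Sum>T\<in>A. (1 / real q ^ card R) ^ g)
      = real (card R choose k) * (1 / real q ^ g) ^ k * (1 - 1 / real q ^ g) ^ (card R - k)"
  proof (cases "k \<le> card R")
    case True
    \<comment> \<open>Each table has limiting weight p^N; of these N factors, N - k cancel the
      powers of q^g in \<open>card A\<close>.\<close>
    define p where "p = 1 / real q ^ g"
    have "real (q ^ g - 1) = real q ^ g * (1 - p)"
      using q0 by (simp add: p_def of_nat_diff field_simps)
    then have "real (card A) = real (card R choose k) * ((real q ^ g) * (1 - p)) ^ (card R - k)"
      using card_PiE_hitting_value[OF finR Bb(1,2), of k] by (simp add: A_def Bb)
    moreover have "(1 / real q ^ card R) ^ g = p ^ card R"
      by (simp add: p_def power_one_over mult.commute flip: power_mult)
    then have "(1 / real q ^ card R) ^ g = p ^ k * p ^ (card R - k)"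
      using True by (simp flip: power_add)
    moreover have "p * real q ^ g = 1" using q0 by (simp add: p_def)
    then have "p ^ (card R - k) * (real q ^ g) ^ (card R - k) = 1"
      by (metis power_mult_distrib power_one)
    moreover have "real (card A) * (1 / real q ^ card R) ^ g
        = real (card R choose k) * p ^ k * (1 - p) ^ (card R - k) * (p ^ (card R - k) * (real q ^ g) ^ (card R - k))"
      unfolding calculation(1,2) power_mult_distrib by (simp only: mult_ac)
    ultimately show ?thesis by (simp flip: p_def)
  next
    \<comment> \<open>With more than N trivial rows demanded, both the set of tables and the
      binomial coefficient are zero, so the truncated exponent is harmless.\<close>
    case False
    then have "card A = 0"
      using card_PiE_hitting_value[OF finR Bb(1,2), of k] by (simp add: A_def)
    then show ?thesis using False by simp
  qed
  ultimately show ?thesis by (simp add: cardR q_def)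
qed

end

section \<open>Poisson limit of binomial laws\<close>

lemma binomial_tendsto_poisson:
  fixes N :: "nat \<Rightarrow> nat" and p :: "nat \<Rightarrow> real"
  assumes Np: "(\<lambda>g. real (N g) * p g) \<longlonglongrightarrow> m" and p: "p \<longlonglongrightarrow> 0" "\<And>g. 0 \<le> p g"
  shows "(\<lambda>g. real (N g choose k) * p g ^ k * (1 - p g) ^ (N g - k)) \<longlonglongrightarrow> poisson_pmf m k"
proof -
  have p1: "\<forall>\<^sub>F g in sequentially. p g < 1"
    using order_tendstoD(2)[OF p(1), of 1] by simp
  \<comment> \<open>The falling factorial gives a fixed number \<open>k\<close> of factors, each
    tending to \<open>m\<close> when \<open>x\<close> is \<open>p g\<close> and \<open>n\<close> is
    \<open>N g\<close>.\<close>
  have bin: "real (n choose k) * x ^ k = (\<Prod>i<k. real n * x - real i * x) / fact k" for n and x :: real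
  proof -
    have "(\<Prod>i<k. real n * x - real i * x) = (\<Prod>i<k. (real n - real i) * x)"
      by (simp add: algebra_simps)
    then show ?thesis
      by (simp add: prod.distrib binomial_gbinomial gbinomial_prod_rev atLeast0LessThan)
  qed
  have "(\<lambda>g. real (N g choose k) * p g ^ k) \<longlonglongrightarrow> (\<Prod>i<k. m - real i * 0) / fact k"
    unfolding bin by (intro tendsto_intros Np p) simp
  then have lim1: "(\<lambda>g. real (N g choose k) * p g ^ k) \<longlonglongrightarrow> m ^ k / fact k" by simp

  \<comment> \<open>The bases 1 - p and exp(-p) differ by at most p^2. Both lie in [0,1] once p < 1,
    so their N-th powers differ by at most N p^2, which tends to 0.\<close>
  have "(\<lambda>g. (1 - p g) ^ N g - exp (- (real (N g) * p g))) \<longlonglongrightarrow> 0"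
  proof (rule Lim_null_comparison)
    show "\<forall>\<^sub>F g in sequentially. norm ((1 - p g) ^ N g - exp (- (real (N g) * p g))) \<le> real (N g) * p g * p g"
      using p1
    proof eventually_elim
      case (elim g)
      have "exp (- p g) * (1 + p g) \<le> exp (- p g) * exp (p g)"
        by (intro mult_left_mono) auto
      then have "exp (- p g) \<le> 1 / (1 + p g)" using p(2)[of g] by (simp add: field_simps exp_minus)
      \<comment> \<open>Holds since (1 - p + p^2)(1 + p) = 1 + p^3.\<close>
      also have "\<dots> \<le> 1 - p g + p g * p g" using p(2)[of g] by (simp add: field_simps)
      finally have "\<bar>(1 - p g) - exp (- p g)\<bar> \<le> p g * p g"
        using exp_ge_add_one_self[of "- p g"] by simp
      moreover have "\<bar>(1 - p g) ^ N g - exp (- p g) ^ N g\<bar> \<le> real (N g) * \<bar>(1 - p g) - exp (- p g)\<bar>"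
        using norm_power_diff[of "1 - p g" "exp (- p g)" "N g"] p(2)[of g] elim by simp
      ultimately have "\<bar>(1 - p g) ^ N g - exp (- p g) ^ N g\<bar> \<le> real (N g) * (p g * p g)"
        by (meson mult_left_mono of_nat_0_le_iff order_trans)
      moreover have "exp (- p g) ^ N g = exp (- (real (N g) * p g))"
        by (simp flip: exp_of_nat_mult)
      ultimately show ?case by (simp add: mult.assoc)
    qed
    show "(\<lambda>g. real (N g) * p g * p g) \<longlonglongrightarrow> 0"
      using tendsto_mult[OF Np p(1)] by simp
  qed
  from tendsto_add[OF this tendsto_exp[OF tendsto_minus[OF Np]]]
  have lim2: "(\<lambda>g. (1 - p g) ^ N g) \<longlonglongrightarrow> exp (- m)" by simp
  \<comment> \<open>The exponent N - k is obtained by dividing by (1 - p)^k, nonzero once p < 1; for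
    k > N the binomial coefficient vanishes.\<close>
  have "(\<lambda>g. real (N g choose k) * p g ^ k * ((1 - p g) ^ N g / (1 - p g) ^ k))
      \<longlonglongrightarrow> m ^ k / fact k * (exp (- m) / (1 - 0) ^ k)"
    by (intro tendsto_intros lim1 lim2 p(1)) simp
  moreover have "\<forall>\<^sub>F g in sequentially. real (N g choose k) * p g ^ k * ((1 - p g) ^ N g / (1 - p g) ^ k)
      = real (N g choose k) * p g ^ k * (1 - p g) ^ (N g - k)"
    using p1
  proof eventually_elim
    case (elim g)
    then show ?case by (cases "k \<le> N g") (simp_all add: power_diff binomial_eq_0)
  qed
  ultimately show ?thesis
    by (simp add: poisson_pmf_def tendsto_cong)
qed

text \<open>The exponent |Q|^g mu is the natural number \<open>N_epi Q g\<close>. Convergence of the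
  distributions is expressed pointwise in \<open>k\<close>, with \<open>L g\<close> the limit law
  for fixed \<open>g\<close>.\<close>

theorem theorem3p5:
  fixes Q :: "('a, 'b) monoid_scheme"
  assumes "simple_group Q" and "\<not> comm_group Q" and "finite (carrier Q)"
  shows "(\<forall>g \<ge> 1. (\<lambda>n. prob_pres g n (\<lambda>P. num_epi Q g P \<ge> 1))
            \<longlonglongrightarrow> 1 - (1 - 1 / real (card (carrier Q)) ^ g)
                      ^ N_epi Q g)
       \<and> (mu Q \<longlonglongrightarrow> 1 / real (card (auto Q)))
       \<and> (\<exists>L :: nat \<Rightarrow> nat \<Rightarrow> real.
            (\<forall>g \<ge> 1. \<forall>k. (\<lambda>n. prob_pres g n (\<lambda>P. num_epi Q g P = k)) \<longlonglongrightarrow> L g k)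
          \<and> (\<forall>k. (\<lambda>g. L g k) \<longlonglongrightarrow> poisson_pmf (1 / real (card (auto Q))) k))"
proof -
  interpret finite_nonabelian_simple_group Q
    using assms by (simp add: finite_nonabelian_simple_group_def finite_nonabelian_simple_group_axioms_def)
  define p where "p g = 1 / real (card (carrier Q)) ^ g" for g
  \<comment> \<open>The binomial law with N trials and success probability
    \<open>p g\<close>.\<close>
  define L where "L g k = real (N_epi Q g choose k) * p g ^ k * (1 - p g) ^ (N_epi Q g - k)" for g k
  have lim: "(\<lambda>n. prob_pres g n (\<lambda>P. num_epi Q g P = k)) \<longlonglongrightarrow> L g k" for g k
    unfolding L_def p_def by (rule prob_num_epi_tendsto)
  \<comment> \<open>The complement rule needs the set of presentations to be nonempty and finite, as
    division by zero would give probability 0 to both events.\<close>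
  have "prob_pres g n (\<lambda>P. num_epi Q g P \<ge> 1) = 1 - prob_pres g n (\<lambda>P. num_epi Q g P = 0)" for g n
  proof -
    have "finite (letters g)" "letters g \<noteq> {}" by (auto simp: letters_def)
    have pres: "presentations g n = {P. length P = g \<and> (\<forall>j<g. P ! j \<in> {w. set w \<subseteq> letters g \<and> length w = n})}"
      by (auto simp: presentations_def all_set_conv_all_nth)
    have "card (presentations g n) = (card (letters g) ^ n) ^ g"
      unfolding pres card_lists_of_nth_in using \<open>finite (letters g)\<close> by (simp add: card_lists_length_eq)
    then have pos: "card (presentations g n) > 0"
      using \<open>finite (letters g)\<close> \<open>letters g \<noteq> {}\<close> by (simp add: card_gt_0_iff)
    then have fin: "finite (presentations g n)" and ne: "presentations g n \<noteq> {}" by (auto simp: card_gt_0_iff)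
    have "{P \<in> presentations g n. num_epi Q g P \<ge> 1} = presentations g n - {P \<in> presentations g n. num_epi Q g P = 0}"
      by auto
    moreover have "card {P \<in> presentations g n. num_epi Q g P = 0} \<le> card (presentations g n)"
      using fin by (intro card_mono) auto
    ultimately show ?thesis
      using fin ne by (simp add: prob_pres_def card_Diff_subset of_nat_diff diff_divide_distrib)
  qed
  moreover have "(\<lambda>n. 1 - prob_pres g n (\<lambda>P. num_epi Q g P = 0)) \<longlonglongrightarrow> 1 - (1 - p g) ^ N_epi Q g" for g
    using tendsto_diff[OF tendsto_const[of 1] lim[of g 0]] by (simp add: L_def)
  moreover note mu = mu_tendsto[OF finite_carrier]
  moreover have "(\<lambda>g. L g k) \<longlonglongrightarrow> poisson_pmf (1 / real (card (auto Q))) k" for k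
    unfolding L_def
  proof (rule binomial_tendsto_poisson)
    \<comment> \<open>The mean of the binomial law is exactly \<open>mu Q g\<close>.\<close>
    show "(\<lambda>g. real (N_epi Q g) * p g) \<longlonglongrightarrow> 1 / real (card (auto Q))"
      using mu by (simp add: p_def mu_def[abs_def])
    have "card (carrier Q) > 1" using order_gt_one by (simp add: order_def)
    then have "(\<lambda>g. (1 / real (card (carrier Q))) ^ g) \<longlonglongrightarrow> 0"
      by (intro LIMSEQ_power_zero) auto
    then show "p \<longlonglongrightarrow> 0" by (simp add: p_def[abs_def] power_one_over)
  qed (simp add: p_def)
  ultimately show ?thesis
    using lim by (simp add: p_def) blast
qed

end
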